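(* Let $\mathcal{G}=(\mathbf{V},\mathbf{E})$ be the causal DAG of a SEM with observable variables $\mathbf{N}\subseteq\mathbf{V}$ and joint distribution $P$, let $\mathcal{C}\subseteq\Lambda_{\mathcal{G}}$ be the set of control variables, and let $\mathbf{c}\in D_{\mathcal{C}}$. Suppose $(Y,X)\in\mathbf{E}$ is such that $X$ is not a function of $Y$ when $\mathcal{C}=\mathbf{c}$. Let $\mathcal{H}$ be the DAG obtained by removing $(Y,X)$ from $\mathcal{G}$. If (I) $X,Y\in\mathbf{N}$ and (II) $X$ and $Y$ are d-separable in $\mathcal{H}$ given a subset of $\mathbf{N}$, then the label-learning algorithm described in the context, run on $\mathcal{G}$ and $P(\mathbf{N})$, correctly adds $(Y,X)$ to $\mathcal{L}_{\mathcal{C}}(\mathbf{c})$.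
   Context: All variables are discrete with finite domains; $D_{\mathcal{C}}$ is the domain of $\mathcal{C}$. $\mathbf{V}=\mathbf{N}\cup\mathbf{U}$ with $\mathbf{N}$ observable and $\mathbf{U}$ unobservable. $Pa_X$ and $Anc_X$ denote the parents and ancestors of $X$ in $\mathcal{G}$, with $X\in Anc_X$, and $Anc_{\mathbf{X}}=\bigcup_{X\in\mathbf{X}}Anc_X$. $\Lambda_{\mathcal{G}}$ is the set of observed vertices without parents. A structural equation model (SEM) with causal graph $\mathcal{G}$ generates each $X\in\mathbf{V}$ as $X=f_X(Pa_X,\epsilon_X)$, with $f_X$ deterministic and noises $\epsilon_X$ jointly independent. "$X$ is not a function of $Y$ when $\mathcal{C}=\mathbf{c}$" means that $f_X$ does not depend on its argument $Y$ once $\mathcal{C}$ is set to $\mathbf{c}$. $X$ and $Y$ are d-separable in $\mathcal{H}$ given a subset of $\mathbf{N}$ if there is a set $\mathbf{S}\subseteq\mathbf{N}\setminus\{X,Y\}$ that d-separates $X$ and $Y$ in $\mathcal{H}$. Label set. For $\mathbf{c}\in D_{\mathcal{C}}$, $\mathcal{L}_{\mathcal{C}}(\mathbf{c})$ is a set of edges $(Y,X)\in\mathbf{E}$ such that $X$ is independent of $Y$ given $\mathcal{C}=\mathbf{c}$ and $\mathbf{S}$, for some $\mathbf{S}\subseteq\mathbf{V}\setminus(\{X,Y\}\cup\mathcal{C})$; and $\mathcal{L}_{\mathcal{C}}=(\mathcal{L}_{\mathcal{C}}(\mathbf{c}):\mathbf{c}\in D_{\mathcal{C}})$. Label-learning algorithm.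 Input: $\mathcal{G}$ and $P(\mathbf{N})$. For each $\mathbf{c}\in D_{\mathcal{C}}$ and each pair $X,Y\in\mathbf{N}$ with $(Y,X)\in\mathbf{E}$: if, under $P$, $X$ is conditionally independent of $Y$ given $\mathcal{C}=\mathbf{c}$ and the variables $(Anc_{\{X,Y\}}\cap\mathbf{N})\setminus(\mathcal{C}\cup\{X,Y\})$, then add $(Y,X)$ to $\mathcal{L}_{\mathcal{C}}(\mathbf{c})$. Output: $\mathcal{L}_{\mathcal{C}}$. (Labels start empty.) *)

theory Defs
  imports "HOL-Probability.Probability"
begin

text \<open>A causal graph is a finite vertex set together with a relation \<open>E\<close>, where
  \<open>(Y, X) \<in> E\<close> is the edge from \<open>Y\<close> to \<open>X\<close>.\<close>

definition parents :: "('v \<times> 'v) set \<Rightarrow> 'v \<Rightarrow> 'v set" where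
  "parents E X = {Y. (Y, X) \<in> E}"

definition ancestors :: "('v \<times> 'v) set \<Rightarrow> 'v set \<Rightarrow> 'v set" where
  "ancestors E A = {Y. \<exists>X\<in>A. (Y, X) \<in> E\<^sup>*}"

definition descendants :: "('v \<times> 'v) set \<Rightarrow> 'v \<Rightarrow> 'v set" where
  "descendants E X = {Y. (X, Y) \<in> E\<^sup>*}"

definition observed_roots :: "('v \<times> 'v) set \<Rightarrow> 'v set \<Rightarrow> 'v set" where
  "observed_roots E N = {X \<in> N. parents E X = {}}"


definition skeleton_path :: "('v \<times> 'v) set \<Rightarrow> 'v \<Rightarrow> 'v list \<Rightarrow> 'v \<Rightarrow> bool" where
  "skeleton_path E X p Y \<longleftrightarrow>
     p \<noteq> [] \<and> hd p = X \<and> last p = Y \<and> distinct p \<and>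
     successively (\<lambda>a b. (a, b) \<in> E \<or> (b, a) \<in> E) p"

definition collider_at :: "('v \<times> 'v) set \<Rightarrow> 'v list \<Rightarrow> nat \<Rightarrow> bool" where
  "collider_at E p i \<longleftrightarrow> (p ! (i - 1), p ! i) \<in> E \<and> (p ! (i + 1), p ! i) \<in> E"

text \<open>Only inner vertices of the path can block it; \<open>descendants\<close> is reflexive, so a collider
  blocks iff neither it nor any proper descendant lies in \<open>S\<close>.\<close>

definition blocked_by :: "('v \<times> 'v) set \<Rightarrow> 'v set \<Rightarrow> 'v list \<Rightarrow> bool" where
  "blocked_by E S p \<longleftrightarrow>
     (\<exists>i. 0 < i \<and> i + 1 < length p \<and>
        (if collider_at E p i then descendants E (p ! i) \<inter> S = {} else p ! i \<in> S))"

definition d_separates :: "('v \<times> 'v) set \<Rightarrow> 'v set \<Rightarrow> 'v \<Rightarrow> 'v \<Rightarrow> bool" where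
  "d_separates E S X Y \<longleftrightarrow> (\<forall>p. skeleton_path E X p Y \<longrightarrow> blocked_by E S p)"

definition d_separable :: "('v \<times> 'v) set \<Rightarrow> 'v set \<Rightarrow> 'v \<Rightarrow> 'v \<Rightarrow> bool" where
  "d_separable E N X Y \<longleftrightarrow> (\<exists>S. S \<subseteq> N - {X, Y} \<and> d_separates E S X Y)"


text \<open>Variables take values in finite domains \<open>D X\<close>; the noise \<open>\<epsilon> X\<close> may take values in an
  arbitrary measurable space \<open>M X\<close>. An assignment to the variables in \<open>A\<close> is an element of
  \<open>PiE A D\<close>; in particular \<open>f X\<close> only ever receives the values of the parents of \<open>X\<close>.
  Measurability of \<open>val X\<close> follows from the structural equations by acyclicity.\<close>

locale sem = prob_space \<Omega>
  for \<Omega> :: "'w measure" +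
  fixes V N :: "'v set"
    and E :: "('v \<times> 'v) set"
    and D :: "'v \<Rightarrow> 'a set"
    and M :: "'v \<Rightarrow> 'e measure"
    and \<epsilon> :: "'v \<Rightarrow> 'w \<Rightarrow> 'e"
    and f :: "'v \<Rightarrow> ('v \<Rightarrow> 'a) \<Rightarrow> 'e \<Rightarrow> 'a"
    and val :: "'v \<Rightarrow> 'w \<Rightarrow> 'a"
  assumes finite_vertices: "finite V"
    and observables: "N \<subseteq> V"
    and edges: "E \<subseteq> V \<times> V"
    and acyclic_graph: "acyclic E"
    and finite_domain: "\<And>X. X \<in> V \<Longrightarrow> finite (D X)"
    and indep_noises: "indep_vars M \<epsilon> V"
    and mechanism: "\<And>X pa. X \<in> V \<Longrightarrow> pa \<in> PiE (parents E X) D \<Longrightarrow>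
                      f X pa \<in> measurable (M X) (count_space (D X))"
    and structural_equation: "\<And>X \<omega>. X \<in> V \<Longrightarrow> \<omega> \<in> space \<Omega> \<Longrightarrow>
                      val X \<omega> = f X (restrict (\<lambda>Y. val Y \<omega>) (parents E X)) (\<epsilon> X \<omega>)"

definition law_of :: "'w measure \<Rightarrow> ('v \<Rightarrow> 'a set) \<Rightarrow> ('v \<Rightarrow> 'w \<Rightarrow> 'a) \<Rightarrow> 'v set
    \<Rightarrow> ('v \<Rightarrow> 'a) measure" where
  "law_of \<Omega> D val A = distr \<Omega> (count_space (PiE A D)) (\<lambda>\<omega>. restrict (\<lambda>X. val X \<omega>) A)"

definition not_function_of ::
  "('v \<times> 'v) set \<Rightarrow> ('v \<Rightarrow> 'a set) \<Rightarrow> ('v \<Rightarrow> 'e measure) \<Rightarrow> ('v \<Rightarrow> ('v \<Rightarrow> 'a) \<Rightarrow> 'e \<Rightarrow> 'a)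
    \<Rightarrow> 'v set \<Rightarrow> ('v \<Rightarrow> 'a) \<Rightarrow> 'v \<Rightarrow> 'v \<Rightarrow> bool" where
  "not_function_of E D M f C c X Y \<longleftrightarrow>
     (\<forall>pa \<in> PiE (parents E X) D. \<forall>pa' \<in> PiE (parents E X) D.
        (\<forall>W \<in> parents E X \<inter> C. pa W = c W \<and> pa' W = c W) \<longrightarrow>
        (\<forall>W \<in> parents E X - {Y}. pa W = pa' W) \<longrightarrow>
        (\<forall>e \<in> space (M X). f X pa e = f X pa' e))"

text \<open>Conditional independence of \<open>X\<close> and \<open>Y\<close> given \<open>C = c\<close> and the variables in \<open>S\<close>, for a
  law \<open>Q\<close> on assignments. Values outside the domains need no exclusion: they only give
  events of probability zero.\<close>

definition cond_indep ::
  "('v \<Rightarrow> 'a) measure \<Rightarrow> 'v set \<Rightarrow> ('v \<Rightarrow> 'a) \<Rightarrow> 'v set \<Rightarrow> 'v \<Rightarrow> 'v \<Rightarrow> bool" where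
  "cond_indep Q C c S X Y \<longleftrightarrow>
     (\<forall>s x y. let given = (\<lambda>v. (\<forall>W\<in>C. v W = c W) \<and> (\<forall>W\<in>S. v W = s W)) in
        \<P>(v in Q. given v) > 0 \<longrightarrow>
        \<P>(v in Q. v X = x \<and> v Y = y \<bar> given v) =
        \<P>(v in Q. v X = x \<bar> given v) * \<P>(v in Q. v Y = y \<bar> given v))"

text \<open>The edges that may belong to a label set at \<open>c\<close>: a label set for \<open>C\<close> is any family \<open>L\<close>
  with \<open>L c \<subseteq> valid_labels P V E C c\<close> for all \<open>c \<in> PiE C D\<close>, where \<open>P\<close> is the joint law on \<open>V\<close>.\<close>

definition valid_labels ::
  "('v \<Rightarrow> 'a) measure \<Rightarrow> 'v set \<Rightarrow> ('v \<times> 'v) set \<Rightarrow> 'v set \<Rightarrow> ('v \<Rightarrow> 'a) \<Rightarrow> ('v \<times> 'v) set" where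
  "valid_labels P V E C c =
     {(Y, X). (Y, X) \<in> E \<and> (\<exists>S. S \<subseteq> V - ({X, Y} \<union> C) \<and> cond_indep P C c S X Y)}"

text \<open>Output of the label-learning algorithm on the graph and the law \<open>PN\<close> of the observables.
  The iterations of its loop do not interact, so the result is given in closed form.\<close>

definition learned_labels ::
  "('v \<times> 'v) set \<Rightarrow> 'v set \<Rightarrow> ('v \<Rightarrow> 'a set) \<Rightarrow> 'v set \<Rightarrow> ('v \<Rightarrow> 'a) measure
    \<Rightarrow> ('v \<Rightarrow> 'a) \<Rightarrow> ('v \<times> 'v) set" where
  "learned_labels E N D C PN =
     (\<lambda>c \<in> PiE C D.
        {(Y, X). X \<in> N \<and> Y \<in> N \<and> (Y, X) \<in> E \<and>
           cond_indep PN C c ((ancestors E {X, Y} \<inter> N) - (C \<union> {X, Y})) X Y})"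

end

theory Submission imports Defs
begin

text \<open>Write \<open>A\<close> for the ancestors of \<open>X\<close> and \<open>Y\<close>, and moralize \<open>H\<close> on \<open>A\<close>. If \<open>X\<close> and \<open>Y\<close> were
  connected in the moral graph through unobserved vertices only, the connection would be an
  inducing path: its non-colliders are unobserved and its colliders are ancestors of \<open>X\<close> or \<open>Y\<close>,
  so it could be turned into a path of \<open>H\<close> that is open given any \<open>S \<subseteq> N - {X, Y}\<close>,
  contradicting d-separability. Let \<open>W\<close> be the component of \<open>Y\<close> among the unobserved vertices
  and \<open>X\<close>, \<open>Y\<close>; thus \<open>X \<notin> W\<close>. Once \<open>C = c\<close> and the observed ancestors are fixed, the structural
  equations of the vertices whose \<open>H\<close>-family meets \<open>W\<close> and the remaining ones have no free
  variable in common, because \<open>f X\<close> ignores \<open>Y\<close>. The two systems are driven by disjoint sets of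
  noises, so their solvability events are independent, and these events factorize the law.\<close>

section \<open>Open walks and inducing paths\<close>


text \<open>Blocking is local to three consecutive vertices; in this form it applies to walks that
  repeat vertices, which are easier to extend than paths.\<close>

definition passes :: "('v \<times> 'v) set \<Rightarrow> 'v set \<Rightarrow> 'v \<Rightarrow> 'v \<Rightarrow> 'v \<Rightarrow> bool" where
  "passes E S a b d \<longleftrightarrow>
     (if (a, b) \<in> E \<and> (d, b) \<in> E then descendants E b \<inter> S \<noteq> {} else b \<notin> S)"

fun open_walk :: "('v \<times> 'v) set \<Rightarrow> 'v set \<Rightarrow> 'v list \<Rightarrow> bool" where
  "open_walk E S [] = True"
| "open_walk E S [a] = True"
| "open_walk E S [a, b] = ((a, b) \<in> E \<or> (b, a) \<in> E)"
| "open_walk E S (a # b # d # p) =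
     (((a, b) \<in> E \<or> (b, a) \<in> E) \<and> passes E S a b d \<and> open_walk E S (b # d # p))"

lemma descendants_refl: "a \<in> descendants E a"
  by (simp add: descendants_def)

lemma descendants_mono: "(a, b) \<in> E\<^sup>* \<Longrightarrow> descendants E b \<subseteq> descendants E a"
  by (auto simp: descendants_def)

lemma blocked_by_Cons:
  "blocked_by E S (a # b # d # p) \<longleftrightarrow> \<not> passes E S a b d \<or> blocked_by E S (b # d # p)"
proof -
  let ?q = "a # b # d # p" and ?r = "b # d # p"
  let ?B = "\<lambda>p i. if collider_at E p i then descendants E (p ! i) \<inter> S = {} else p ! i \<in> S"
  have 1: "?B ?q (Suc 0) \<longleftrightarrow> \<not> passes E S a b d"
    by (simp add: collider_at_def passes_def)
  \<comment> \<open>The shift needs \<open>0 < i\<close>: \<open>collider_at\<close> looks back to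
    \<open>i - 1\<close>, which truncates at \<open>i = 0\<close>.\<close>
  have 2: "?B ?q (Suc i) \<longleftrightarrow> ?B ?r i" if "0 < i" for i
    using that by (cases i) (simp_all add: collider_at_def)
  show ?thesis
  proof
    assume "blocked_by E S ?q"
    then obtain i where i: "0 < i" "i + 1 < length ?q" "?B ?q i"
      unfolding blocked_by_def by blast
    show "\<not> passes E S a b d \<or> blocked_by E S ?r"
    proof (cases "i = Suc 0")
      case True
      show ?thesis using i(3) 1 unfolding True by blast
    next
      case False
      then obtain j where "i = Suc j" "0 < j" using i(1) by (cases i) auto
      then show ?thesis using i 2[of j] unfolding blocked_by_def by fastforce
    qed
  next
    assume "\<not> passes E S a b d \<or> blocked_by E S ?r"
    then show "blocked_by E S ?q"
    proof
      assume "\<not> passes E S a b d"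
      then show ?thesis using 1 unfolding blocked_by_def by (intro exI[of _ "Suc 0"]) simp
    next
      assume "blocked_by E S ?r"
      then obtain i where i: "0 < i" "i + 1 < length ?r" "?B ?r i"
        unfolding blocked_by_def by blast
      then show ?thesis using 2[of i] unfolding blocked_by_def by (intro exI[of _ "Suc i"]) simp
    qed
  qed
qed

lemma open_walk_iff:
  "open_walk E S p \<longleftrightarrow> successively (\<lambda>a b. (a, b) \<in> E \<or> (b, a) \<in> E) p \<and> \<not> blocked_by E S p"
  by (induction E S p rule: open_walk.induct)
     (auto simp: blocked_by_Cons, auto simp: blocked_by_def)

text \<open>Openness is a condition on edges and consecutive triples, so the pieces must share two
  vertices for every triple to lie inside one of them.\<close>

lemma open_walk_append:
  "open_walk E S (xs @ a # b # ys) \<longleftrightarrow> open_walk E S (xs @ [a, b]) \<and> open_walk E S (a # b # ys)"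
proof (induction xs)
  case Nil
  show ?case by (cases ys) auto
next
  case (Cons x xs)
  show ?case
  proof (cases xs)
    case Nil
    then show ?thesis using Cons by auto
  next
    case (Cons y zs)
    then show ?thesis using Cons.IH by (cases zs) auto
  qed
qed

lemma open_walk_ConsD: "open_walk E S (a # p) \<Longrightarrow> open_walk E S p"
  by (cases "(E, S, a # p)" rule: open_walk.cases) auto

lemma open_walk_appendD2: "open_walk E S (p @ q) \<Longrightarrow> open_walk E S q"
  by (induction p) (auto dest: open_walk_ConsD)

lemma open_walk_appendD1: "open_walk E S (p @ q) \<Longrightarrow> open_walk E S p"
proof (induction E S p rule: open_walk.induct)
  case (3 E S a b)
  then show ?case by (cases q) auto
qed auto

text \<open>The walk starts forwards and ends backwards, so it has a collider, and the first one is a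
  descendant of \<open>b\<close>.\<close>

lemma descendant_of_turning_walk:
  assumes "asym E"
  shows "open_walk E S (a # b # r) \<Longrightarrow> (a, b) \<in> E \<Longrightarrow>
    (last (b # r), last (butlast (a # b # r))) \<in> E \<Longrightarrow> descendants E b \<inter> S \<noteq> {}"
proof (induction r arbitrary: a b)
  case Nil
  then show ?case using assms by (auto dest: asymD)
next
  case (Cons d r)
  show ?case
  proof (cases "(d, b) \<in> E")
    case True
    then show ?thesis using Cons.prems by (simp add: passes_def)
  next
    case False
    then have bd: "(b, d) \<in> E"
      using Cons.prems(1) by (cases r) auto
    have "descendants E d \<inter> S \<noteq> {}"
      using Cons.IH[of b d] Cons.prems bd by auto
    then show ?thesis using descendants_mono[of b d E] bd by auto
  qed
qed

text \<open>Only the triple around \<open>w\<close> is new. If \<open>w\<close> is a collider there,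
  the old walk between its neighbours turns around, so \<open>w\<close> has a descendant in
  \<open>S\<close>; otherwise \<open>w\<close> was a non-collider in one of the two old triples and
  hence is outside \<open>S\<close>.\<close>

lemma open_walk_remove_loop:
  assumes "asym E" and walk: "open_walk E S (xs @ w # ys @ w # zs)"
  shows "open_walk E S (xs @ w # zs)"
proof (cases "xs = [] \<or> zs = []")
  case True
  then show ?thesis
  proof
    assume "xs = []"
    then show ?thesis using open_walk_appendD2[of E S "w # ys" "w # zs"] walk by simp
  next
    assume "zs = []"
    then show ?thesis using open_walk_appendD1[of E S "xs @ [w]" "ys @ [w]"] walk by simp
  qed
next
  case False
  then obtain xs' a d zs' where xs: "xs = xs' @ [a]" and zs: "zs = d # zs'"
    by (metis neq_Nil_conv rev_exhaust)
  \<comment> \<open>\<open>g\<close> follows the first \<open>w\<close> and \<open>h\<close>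
    precedes the second; including \<open>w\<close> itself in the split covers an empty
    \<open>ys\<close>.\<close>
  obtain g gs where g: "ys @ [w] = g # gs"
    by (cases "ys @ [w]") auto
  obtain h hs where h: "w # ys = hs @ [h]"
    by (cases "w # ys" rule: rev_cases) auto
  have "open_walk E S (xs' @ a # w # (ys @ w # d # zs'))"
    using walk xs zs by simp
  then have pre: "open_walk E S (xs' @ [a, w])" and mid: "open_walk E S (a # w # ys @ w # d # zs')"
    using open_walk_append[of E S xs' a w] by blast+
  have "a # w # ys @ w # d # zs' = (a # hs) @ h # w # d # zs'"
    using arg_cong[OF h, of "\<lambda>l. a # l @ w # d # zs'"] by simp
  then have "open_walk E S ((a # hs) @ h # w # d # zs')" using mid by argo
  then have passes2: "passes E S h w d" and post: "open_walk E S (w # d # zs')"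
    using open_walk_appendD2[of E S "a # hs" "h # w # d # zs'"] by auto
  have "a # w # ys @ w # d # zs' = a # w # g # gs @ d # zs'"
    using arg_cong[OF g, of "\<lambda>l. a # w # l @ d # zs'"] by simp
  then have "open_walk E S (a # w # g # gs @ d # zs')" using mid by argo
  then have passes1: "passes E S a w g" by simp
  have "passes E S a w d"
  proof (cases "(a, w) \<in> E \<and> (d, w) \<in> E")
    case True
    have "open_walk E S (a # w # ys @ [w, d])"
      using open_walk_appendD1[of E S "a # w # ys @ [w, d]" zs'] mid by simp
    then have "descendants E w \<inter> S \<noteq> {}"
      using descendant_of_turning_walk[OF assms(1), of S a w "ys @ [w, d]"] True
      by (simp add: butlast_append)
    then show ?thesis using True by (simp add: passes_def)
  next
    case False
    then show ?thesis using passes1 passes2 by (auto simp: passes_def split: if_splits)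
  qed
  moreover have "(a, w) \<in> E \<or> (w, a) \<in> E"
    using open_walk_appendD2[OF pre] by simp
  ultimately have "open_walk E S (a # w # d # zs')"
    using post by simp
  then have "open_walk E S (xs' @ a # w # d # zs')"
    using pre open_walk_append[of E S xs' a w "d # zs'"] by blast
  then show ?thesis using xs zs by simp
qed

text \<open>Cutting out loops shortens the walk, so induction on its length ends in an open
  path.\<close>

lemma open_walk_imp_not_d_separates:
  assumes "asym E" "open_walk E S p" "p \<noteq> []" "hd p = X" "last p = Y"
  shows "\<not> d_separates E S X Y"
  using assms(2-)
proof (induction "length p" arbitrary: p rule: less_induct)
  case less
  show ?case
  proof (cases "distinct p")
    case True
    then show ?thesis
      using less.prems unfolding d_separates_def skeleton_path_def open_walk_iff by blast
  next
    case False
    then obtain xs w ys zs where p: "p = xs @ w # ys @ w # zs"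
      using not_distinct_decomp[OF False] by auto
    show ?thesis
    proof (rule less.hyps)
      show "open_walk E S (xs @ w # zs)"
        using open_walk_remove_loop[OF assms(1)] less.prems(1) p by blast
      show "hd (xs @ w # zs) = X"
        using less.prems p by (cases xs) auto
      show "last (xs @ w # zs) = Y"
        using less.prems p by (auto split: if_splits)
    qed (use p in auto)
  qed
qed

section \<open>Open walks to \<open>Y\<close>, extended at the front\<close>

definition reaches :: "('v \<times> 'v) set \<Rightarrow> 'v set \<Rightarrow> 'v \<Rightarrow> 'v \<Rightarrow> bool" where
  "reaches E S a Y \<longleftrightarrow> (\<exists>p. open_walk E S (a # p) \<and> last (a # p) = Y)"

lemma open_walk_extend:
  assumes "open_walk E S (a # p)" "(b, a) \<in> E \<or> (a, b) \<in> E" "p \<noteq> [] \<Longrightarrow> passes E S b a (hd p)"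
  shows "open_walk E S (b # a # p)"
  using assms by (cases p) auto

text \<open>The edge leaves \<open>a\<close>, so \<open>a\<close> is a non-collider in the longer
  walk, whatever vertex follows it.\<close>

lemma reaches_out:
  assumes "asym E" "reaches E S a Y" "(a, b) \<in> E" "a \<notin> S"
  shows "reaches E S b Y"
proof -
  obtain p where p: "open_walk E S (a # p)" "last (a # p) = Y"
    using assms(2) by (auto simp: reaches_def)
  have "open_walk E S (b # a # p)"
    using assms p by (intro open_walk_extend) (auto simp: passes_def dest: asymD)
  then show ?thesis using p unfolding reaches_def by (intro exI[of _ "a # p"]) auto
qed

text \<open>All vertices passed are descendants of \<open>a\<close>, hence outside \<open>S\<close>,
  and each is left along an outgoing edge.\<close>

lemma reaches_directed:
  assumes "asym E" "reaches E S a Y" "(a, b) \<in> E\<^sup>*" "descendants E a \<inter> S = {}"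
  shows "reaches E S b Y"
  using assms(3)
proof (induction rule: rtrancl_induct)
  case base
  then show ?case using assms by simp
next
  case (step y z)
  then have "y \<notin> S" using assms(4) by (auto simp: descendants_def)
  then show ?case using reaches_out[OF assms(1)] step by blast
qed

text \<open>A directed path has no collider. Its outgoing first edge is recorded so that
  \<open>a\<close> stays a non-collider when a vertex is put in front of it.\<close>

lemma open_walk_directed:
  assumes "asym E" "(a, Y) \<in> E\<^sup>*" "descendants E a \<inter> S = {}"
  shows "\<exists>p. open_walk E S (a # p) \<and> last (a # p) = Y \<and> (p \<noteq> [] \<longrightarrow> (a, hd p) \<in> E)"
  using assms(2,3)
proof (induction rule: converse_rtrancl_induct)
  case base
  show ?case by (intro exI[of _ "[]"]) auto
next
  case (step a b)
  have "descendants E b \<inter> S = {}"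
    using descendants_mono[of a b E] step by auto
  then obtain p where p: "open_walk E S (b # p)" "last (b # p) = Y" "p \<noteq> [] \<longrightarrow> (b, hd p) \<in> E"
    using step by blast
  have "b \<notin> S" using step by (auto simp: descendants_def)
  then have "open_walk E S (a # b # p)"
    using p step assms(1) by (intro open_walk_extend) (auto simp: passes_def dest: asymD)
  then show ?case using p step by (intro exI[of _ "b # p"]) auto
qed

text \<open>A collider that is not an ancestor of \<open>S\<close> is bypassed along a directed path to one of
  the two end points.\<close>

lemma reaches_edge:
  assumes "asym E" "reaches E S a Y" "a \<notin> S" "a \<in> ancestors E {X, Y}"
    "(a, b) \<in> E \<or> (b, a) \<in> E"
  shows "reaches E S b Y \<or> reaches E S X Y"
proof (cases "(a, b) \<in> E")
  case True
  then show ?thesis using reaches_out assms by metis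
next
  case False
  then have ba: "(b, a) \<in> E" using assms by auto
  show ?thesis
  proof (cases "descendants E a \<inter> S = {}")
    case True
    consider "(a, X) \<in> E\<^sup>*" | "(a, Y) \<in> E\<^sup>*"
      using assms(4) by (auto simp: ancestors_def)
    then show ?thesis
    proof cases
      case 1
      then show ?thesis using reaches_directed[OF assms(1,2) _ True] by blast
    next
      case 2
      \<comment> \<open>The walk given for \<open>a\<close> is dropped; \<open>b\<close> goes in
        front of a directed path from \<open>a\<close> to \<open>Y\<close> instead.\<close>
      obtain p where p: "open_walk E S (a # p)" "last (a # p) = Y" "p \<noteq> [] \<longrightarrow> (a, hd p) \<in> E"
        using open_walk_directed[OF assms(1) 2 True] by blast
      have "open_walk E S (b # a # p)"
        using p ba assms by (intro open_walk_extend) (auto simp: passes_def dest: asymD)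
      then show ?thesis using p unfolding reaches_def by (intro disjI1 exI[of _ "a # p"]) auto
    qed
  next
    case False
    obtain p where p: "open_walk E S (a # p)" "last (a # p) = Y"
      using assms(2) by (auto simp: reaches_def)
    \<comment> \<open>As a collider \<open>a\<close> has a descendant in \<open>S\<close>; as a
      non-collider it is outside \<open>S\<close>.\<close>
    have "open_walk E S (b # a # p)"
      using p ba False assms by (intro open_walk_extend) (auto simp: passes_def)
    then show ?thesis using p unfolding reaches_def by (intro disjI1 exI[of _ "a # p"]) auto
  qed
qed

text \<open>If the common child \<open>z\<close> has a descendant in \<open>S\<close>, it is an open
  collider between \<open>a\<close> and \<open>b\<close>. Otherwise \<open>z\<close> is outside
  \<open>S\<close>, and the walk steps to \<open>z\<close> first and then along the edge to
  \<open>b\<close>.\<close>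

lemma reaches_collider:
  assumes "asym E" "reaches E S a Y" "a \<notin> S" "z \<in> ancestors E {X, Y}"
    "(a, z) \<in> E" "(b, z) \<in> E"
  shows "reaches E S b Y \<or> reaches E S X Y"
proof (cases "descendants E z \<inter> S = {}")
  case True
  then have "z \<notin> S" using descendants_refl[of z E] by auto
  then show ?thesis
    using reaches_edge[OF assms(1) reaches_out[OF assms(1,2,5,3)] _ assms(4)] assms(6) by blast
next
  case False
  obtain p where p: "open_walk E S (a # p)" "last (a # p) = Y"
    using assms(2) by (auto simp: reaches_def)
  have "open_walk E S (z # a # p)"
    using p assms by (intro open_walk_extend) (auto simp: passes_def dest: asymD)
  then have "open_walk E S (b # z # a # p)"
    using assms False by (intro open_walk_extend[where a = z]) (auto simp: passes_def)
  then show ?thesis using p unfolding reaches_def by (intro disjI1 exI[of _ "z # a # p"]) auto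
qed

section \<open>Moral connections in the ancestral graph\<close>

definition family :: "('v \<times> 'v) set \<Rightarrow> 'v \<Rightarrow> 'v set" where
  "family E Z = insert Z (parents E Z)"

text \<open>The moral graph on \<open>A\<close>, restricted to \<open>U\<close>: distinct members of
  a family are adjacent or share a child. Families are used because each structural equation relates
  the variables of one family.\<close>

definition moral_edges :: "('v \<times> 'v) set \<Rightarrow> 'v set \<Rightarrow> 'v set \<Rightarrow> ('v \<times> 'v) set" where
  "moral_edges E A U = {(a, b). a \<in> U \<and> b \<in> U \<and> (\<exists>Z\<in>A. a \<in> family E Z \<and> b \<in> family E Z)}"

text \<open>Vertices of \<open>U\<close> are ancestors of \<open>X\<close> or \<open>Y\<close> and
  avoid the separating set \<open>S\<close>, so every moral step from \<open>Y\<close> lifts to an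
  extension of an open walk.\<close>

lemma not_morally_connected:
  assumes "asym E" "d_separable E N X Y"
    and U: "U = ancestors E {X, Y} - N \<union> {X, Y}"
  shows "(Y, X) \<notin> (moral_edges E (ancestors E {X, Y}) U)\<^sup>*"
proof
  let ?R = "moral_edges E (ancestors E {X, Y}) U"
  assume conn: "(Y, X) \<in> ?R\<^sup>*"
  obtain S where S: "S \<subseteq> N - {X, Y}" "d_separates E S X Y"
    using assms(2) by (auto simp: d_separable_def)
  \<comment> \<open>The second disjunct absorbs the case where bypassing a collider already leads to
    \<open>X\<close>.\<close>
  have "reaches E S b Y \<or> reaches E S X Y" if "(Y, b) \<in> ?R\<^sup>*" for b
    using that
  proof (induction rule: rtrancl_induct)
    case base
    show ?case unfolding reaches_def by (intro disjI1 exI[of _ "[]"]) auto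
  next
    case (step a b)
    show ?case
    proof (cases "reaches E S X Y")
      case False
      then have a: "reaches E S a Y" using step by blast
      obtain Z where Z: "Z \<in> ancestors E {X, Y}" "a \<in> family E Z" "b \<in> family E Z" "a \<in> U"
        using step(2) by (auto simp: moral_edges_def)
      have "a \<notin> S" "a \<in> ancestors E {X, Y}"
        using Z(4) S(1) U by (auto simp: ancestors_def)
      with a Z assms(1) show ?thesis
        using reaches_edge[of E S a Y X b] reaches_collider[of E S a Y Z X b]
        unfolding family_def parents_def by blast
    qed simp
  qed
  then have "reaches E S X Y" using conn by blast
  then show False
    using open_walk_imp_not_d_separates[OF assms(1)] S(2) unfolding reaches_def
    by (metis list.distinct(1) list.sel(1))
qed

text \<open>A directed path through the deleted edge can be cut at \<open>Y\<close>, itself one of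
  the two targets.\<close>

lemma ancestors_remove_edge:
  "ancestors (E - {(Y, X)}) {X, Y} = ancestors E {X, Y}"
proof
  show "ancestors (E - {(Y, X)}) {X, Y} \<subseteq> ancestors E {X, Y}"
    unfolding ancestors_def using rtrancl_mono[of "E - {(Y, X)}" E] by blast
  have "\<exists>B\<in>{X, Y}. (Z, B) \<in> (E - {(Y, X)})\<^sup>*" if "(Z, B) \<in> E\<^sup>*" "B \<in> {X, Y}" for Z B
    using that
  proof (induction rule: converse_rtrancl_induct)
    case base
    then show ?case by blast
  next
    case (step Z' Z)
    show ?case
    proof (cases "(Z', Z) = (Y, X)")
      case False
      then show ?thesis using step by (meson Diff_iff converse_rtrancl_into_rtrancl singletonD)
    qed auto
  qed
  then have "Z \<in> ancestors (E - {(Y, X)}) {X, Y}" if "Z \<in> ancestors E {X, Y}" for Z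
    using that unfolding ancestors_def mem_Collect_eq by metis
  then show "ancestors E {X, Y} \<subseteq> ancestors (E - {(Y, X)}) {X, Y}"
    by blast
qed

section \<open>Factorization of the law of a structural equation model\<close>


context sem
begin

section \<open>Measurability of the variables\<close>

lemma parents_subset: "parents E Z \<subseteq> V"
  using edges by (auto simp: parents_def)

lemma wf_edges: "wf E"
  using finite_acyclic_wf[OF _ acyclic_graph] finite_subset[OF edges] finite_vertices by blast

lemma finite_assignments: "A \<subseteq> V \<Longrightarrow> finite (PiE A D)"
  using finite_vertices finite_domain by (intro finite_PiE) (auto intro: finite_subset)

lemma measurable_noise: "Z \<in> V \<Longrightarrow> \<epsilon> Z \<in> measurable \<Omega> (M Z)"
  using indep_noises by (auto simp: indep_vars_def)

lemma val_in_domain: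
  assumes "\<omega> \<in> space \<Omega>"
  shows "Z \<in> V \<Longrightarrow> val Z \<omega> \<in> D Z"
  using wf_edges
proof (induction Z rule: wf_induct_rule)
  case (less Z)
  have "restrict (\<lambda>Y. val Y \<omega>) (parents E Z) \<in> PiE (parents E Z) D"
    using less.IH parents_subset by (auto simp: parents_def)
  then show ?case
    unfolding structural_equation[OF less.prems assms]
    using measurable_space[OF mechanism[OF less.prems]] measurable_space[OF measurable_noise]
      less.prems assms by auto
qed

text \<open>The target is finite and each fibre is a finite intersection of events. Measurability is
  assumed only on \<open>A\<close> because \<open>measurable_val\<close> applies this to parents
  inside its induction.\<close>

lemma measurable_assignment:
  assumes A: "A \<subseteq> V" and "\<And>Z. Z \<in> A \<Longrightarrow> val Z \<in> measurable \<Omega> (count_space (D Z))"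
  shows "(\<lambda>\<omega>. restrict (\<lambda>Z. val Z \<omega>) A) \<in> measurable \<Omega> (count_space (PiE A D))"
proof -
  let ?r = "\<lambda>\<omega>. restrict (\<lambda>Z. val Z \<omega>) A"
  have "finite A" using A finite_vertices finite_subset by blast
  have "?r -` {v} \<inter> space \<Omega> \<in> sets \<Omega>" if v: "v \<in> PiE A D" for v
  proof -
    have "?r -` {v} \<inter> space \<Omega> = {\<omega>\<in>space \<Omega>. \<forall>Z\<in>A. val Z \<omega> \<in> {v Z}}"
      using v by (auto simp: fun_eq_iff restrict_def PiE_def extensional_def)
    moreover have "{\<omega>\<in>space \<Omega>. val Z \<omega> \<in> {v Z}} \<in> sets \<Omega>" if "Z \<in> A" for Z
      using measurable_sets[OF assms(2)[OF that], of "{v Z}"] v that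
      by (simp add: vimage_def Int_def conj_commute PiE_mem)
    ultimately show ?thesis
      using \<open>finite A\<close> by (auto intro!: sets.sets_Collect_finite_All')
  qed
  moreover have "?r \<in> space \<Omega> \<rightarrow> PiE A D"
    using A val_in_domain by auto
  ultimately show ?thesis
    using finite_assignments[OF A] by (subst measurable_count_space_eq2) auto
qed

lemma measurable_val: "Z \<in> V \<Longrightarrow> val Z \<in> measurable \<Omega> (count_space (D Z))"
  using wf_edges
proof (induction Z rule: wf_induct_rule)
  case (less Z)
  let ?P = "PiE (parents E Z) D" and ?r = "\<lambda>\<omega>. restrict (\<lambda>Y. val Y \<omega>) (parents E Z)"
  have r: "?r \<in> measurable \<Omega> (count_space ?P)"
    using less.IH parents_subset by (intro measurable_assignment) (auto simp: parents_def)
  \<comment> \<open>\<open>mechanism\<close> gives measurability in the noise for each fixed parent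
    assignment; there are finitely many of these to glue.\<close>
  have "(\<lambda>\<omega>. (\<lambda>pa \<omega>. f Z pa (\<epsilon> Z \<omega>)) (?r \<omega>) \<omega>) \<in> measurable \<Omega> (count_space (D Z))"
  proof (rule measurable_compose_countable'[OF _ r])
    show "countable ?P" using finite_assignments[OF parents_subset] by (rule countable_finite)
    show "(\<lambda>\<omega>. f Z pa (\<epsilon> Z \<omega>)) \<in> measurable \<Omega> (count_space (D Z))" if "pa \<in> ?P" for pa
      using measurable_compose[OF measurable_noise mechanism] less.prems that by blast
  qed
  then show ?case
    using structural_equation[OF less.prems] by (subst measurable_cong) auto
qed

section \<open>Solving subsystems of the structural equations\<close>

text \<open>On a parent-closed set the equations determine each value from the values of the
  parents, by induction along the edges.\<close>

lemma val_unique: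
  assumes "\<omega> \<in> space \<Omega>" "A \<subseteq> V" and closed: "\<And>Z. Z \<in> A \<Longrightarrow> parents E Z \<subseteq> A"
    and sol: "\<And>Z. Z \<in> A \<Longrightarrow> f Z (restrict v (parents E Z)) (\<epsilon> Z \<omega>) = v Z"
  shows "Z \<in> A \<Longrightarrow> val Z \<omega> = v Z"
  using wf_edges
proof (induction Z rule: wf_induct_rule)
  case (less Z)
  have "restrict (\<lambda>Y. val Y \<omega>) (parents E Z) = restrict v (parents E Z)"
    using less closed by (intro restrict_ext) (auto simp: parents_def)
  then show ?case
    using structural_equation[of Z \<omega>] sol less.prems assms(1,2) by auto
qed

text \<open>The quantified \<open>v\<close> also supplies the values of parents outside
  \<open>G\<close>, so this event depends on the noises of \<open>G\<close> alone.\<close>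

definition solvable :: "('v \<Rightarrow> 'a) set \<Rightarrow> 'v set \<Rightarrow> 'w set" where
  "solvable P G =
     {\<omega> \<in> space \<Omega>. \<exists>v\<in>P. \<forall>Z\<in>G. f Z (restrict v (parents E Z)) (\<epsilon> Z \<omega>) = v Z}"

lemma indep_solvable:
  assumes P: "P \<subseteq> PiE V D" "P' \<subseteq> PiE V D" and G: "G \<subseteq> V" "G' \<subseteq> V" "G \<inter> G' = {}"
  shows "prob (solvable P G \<inter> solvable P' G') = prob (solvable P G) * prob (solvable P' G')"
proof -
  let ?noise = "\<lambda>G \<omega>. restrict (\<lambda>Z. \<epsilon> Z \<omega>) G"
  \<comment> \<open>\<open>B P G\<close> is the event \<open>solvable P G\<close> expressed in the
    space of noise vectors indexed by \<open>G\<close>.\<close>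
  define B where "B P G = {e \<in> space (PiM G M). \<exists>v\<in>P. \<forall>Z\<in>G.
    f Z (restrict v (parents E Z)) (e Z) \<in> {v Z}}" for P G
  have B_sets: "B P G \<in> sets (PiM G M)" if "P \<subseteq> PiE V D" "G \<subseteq> V" for P G
  proof -
    have "{e \<in> space (PiM G M). f Z (restrict v (parents E Z)) (e Z) \<in> {v Z}} \<in> sets (PiM G M)"
      if Z: "Z \<in> G" and v: "v \<in> P" for Z v
    proof -
      have vV: "v \<in> PiE V D" using v \<open>P \<subseteq> PiE V D\<close> by blast
      have "restrict v (parents E Z) \<in> PiE (parents E Z) D"
        using vV parents_subset by (auto simp: PiE_def Pi_def)
      then have "(\<lambda>e. f Z (restrict v (parents E Z)) (e Z)) \<in> measurable (PiM G M) (count_space (D Z))"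
        using measurable_compose[OF measurable_component_singleton[OF Z, of M] mechanism[of Z]] Z \<open>G \<subseteq> V\<close>
        by blast
      moreover have "v Z \<in> D Z" using vV Z \<open>G \<subseteq> V\<close> by auto
      ultimately show ?thesis
        using measurable_sets[of _ "PiM G M" "count_space (D Z)" "{v Z}"]
        by (simp add: vimage_def Int_def conj_commute)
    qed
    moreover have "finite G" "finite P"
      using that finite_vertices finite_assignments[of V] by (auto intro: finite_subset)
    ultimately show ?thesis
      unfolding B_def by (auto intro!: sets.sets_Collect_finite_All' sets.sets_Collect_finite_Ex)
  qed
  have B_eq: "?noise G -` B P G \<inter> space \<Omega> = solvable P G" if "G \<subseteq> V" for P G
    using that measurable_space[OF measurable_noise]
    by (auto simp: B_def solvable_def space_PiM)
  have "indep_var (PiM G M) (?noise G) (PiM G' M) (?noise G')"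
    using indep_var_restrict[OF indep_noises G(3,1,2)] .
  from indep_varD[OF this B_sets[OF P(1) G(1)] B_sets[OF P(2) G(2)]]
  have "prob ((\<lambda>\<omega>. (?noise G \<omega>, ?noise G' \<omega>)) -` (B P G \<times> B P' G') \<inter> space \<Omega>) =
    prob (solvable P G) * prob (solvable P' G')"
    using B_eq G by simp
  moreover have "(\<lambda>\<omega>. (?noise G \<omega>, ?noise G' \<omega>)) -` (B P G \<times> B P' G') \<inter> space \<Omega> =
    solvable P G \<inter> solvable P' G'"
    using B_eq[OF G(1), of P] B_eq[OF G(2), of P'] by blast
  ultimately show ?thesis by simp
qed

section \<open>Conditional independence as a product formula\<close>

lemma prob_law_of:
  assumes "B \<subseteq> V"
  shows "\<P>(v in law_of \<Omega> D val B. \<phi> v) = \<P>(\<omega> in \<Omega>. \<phi> (restrict (\<lambda>Z. val Z \<omega>) B))"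
proof -
  let ?r = "\<lambda>\<omega>. restrict (\<lambda>Z. val Z \<omega>) B"
  have r: "?r \<in> measurable \<Omega> (count_space (PiE B D))"
    using measurable_val assms by (intro measurable_assignment) auto
  have "\<P>(v in law_of \<Omega> D val B. \<phi> v) = prob (?r -` {v \<in> PiE B D. \<phi> v} \<inter> space \<Omega>)"
    unfolding law_of_def by (subst measure_distr[OF r]) auto
  also have "?r -` {v \<in> PiE B D. \<phi> v} \<inter> space \<Omega> = {\<omega> \<in> space \<Omega>. \<phi> (?r \<omega>)}"
    using measurable_space[OF r] by auto
  finally show ?thesis .
qed

text \<open>Multiplying by the squared probability of the conditioning event clears the denominators
  and leaves an identity between probabilities on \<open>\<Omega>\<close>.\<close>

lemma cond_indep_law_ofI:
  assumes "B \<subseteq> V" "C \<union> T \<union> {X, Y} \<subseteq> B"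
    and prod: "\<And>s x y. let given = (\<lambda>\<omega>. (\<forall>W\<in>C. val W \<omega> = c W) \<and> (\<forall>W\<in>T. val W \<omega> = s W)) in
      \<P>(\<omega> in \<Omega>. given \<omega> \<and> val X \<omega> = x \<and> val Y \<omega> = y) * \<P>(\<omega> in \<Omega>. given \<omega>) =
      \<P>(\<omega> in \<Omega>. given \<omega> \<and> val X \<omega> = x) * \<P>(\<omega> in \<Omega>. given \<omega> \<and> val Y \<omega> = y)"
  shows "cond_indep (law_of \<Omega> D val B) C c T X Y"
  unfolding cond_indep_def Let_def
proof (intro allI impI)
  fix s x y
  let ?Q = "law_of \<Omega> D val B"
  let ?g = "\<lambda>v. (\<forall>W\<in>C. v W = c W) \<and> (\<forall>W\<in>T. v W = s W)"
  let ?h = "\<lambda>\<omega>. (\<forall>W\<in>C. val W \<omega> = c W) \<and> (\<forall>W\<in>T. val W \<omega> = s W)"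
  assume pos: "\<P>(v in ?Q. ?g v) > 0"
  have g: "?g (restrict (\<lambda>Z. val Z \<omega>) B) \<longleftrightarrow> ?h \<omega>" for \<omega>
    using assms(2) by (auto simp: subset_iff)
  have X: "restrict (\<lambda>Z. val Z \<omega>) B X = val X \<omega>"
    and Y: "restrict (\<lambda>Z. val Z \<omega>) B Y = val Y \<omega>" for \<omega>
    using assms(2) by auto
  have 0: "\<P>(v in ?Q. ?g v) = \<P>(\<omega> in \<Omega>. ?h \<omega>)"
    by (subst prob_law_of[OF assms(1)]) (simp only: g)
  have 1: "\<P>(v in ?Q. (v X = x \<and> v Y = y) \<and> ?g v) = \<P>(\<omega> in \<Omega>. ?h \<omega> \<and> val X \<omega> = x \<and> val Y \<omega> = y)"
    by (subst prob_law_of[OF assms(1)]) (simp only: g X Y conj_ac)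
  have 2: "\<P>(v in ?Q. v X = x \<and> ?g v) = \<P>(\<omega> in \<Omega>. ?h \<omega> \<and> val X \<omega> = x)"
    by (subst prob_law_of[OF assms(1)]) (simp only: g X conj_ac)
  have 3: "\<P>(v in ?Q. v Y = y \<and> ?g v) = \<P>(\<omega> in \<Omega>. ?h \<omega> \<and> val Y \<omega> = y)"
    by (subst prob_law_of[OF assms(1)]) (simp only: g Y conj_ac)
  show "\<P>(v in ?Q. v X = x \<and> v Y = y \<bar> ?g v) = \<P>(v in ?Q. v X = x \<bar> ?g v) * \<P>(v in ?Q. v Y = y \<bar> ?g v)"
    using prod[of s x y] pos unfolding cond_prob_def 0 1 2 3 Let_def
    by (simp add: field_simps)
qed


text \<open>Conditioning on \<open>C\<close> makes \<open>Y\<close> constant, and a constant is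
  independent of everything.\<close>

lemma cond_indep_of_determined:
  assumes "B \<subseteq> V" "C \<union> T \<union> {X, Y} \<subseteq> B" "Y \<in> C"
  shows "cond_indep (law_of \<Omega> D val B) C c T X Y"
proof (rule cond_indep_law_ofI[OF assms(1,2)], unfold Let_def)
  fix s x y
  let ?g = "\<lambda>\<omega>. (\<forall>W\<in>C. val W \<omega> = c W) \<and> (\<forall>W\<in>T. val W \<omega> = s W)"
  show "\<P>(\<omega> in \<Omega>. ?g \<omega> \<and> val X \<omega> = x \<and> val Y \<omega> = y) * \<P>(\<omega> in \<Omega>. ?g \<omega>) =
    \<P>(\<omega> in \<Omega>. ?g \<omega> \<and> val X \<omega> = x) * \<P>(\<omega> in \<Omega>. ?g \<omega> \<and> val Y \<omega> = y)"
  proof (cases "y = c Y")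
    case True
    then have "{\<omega> \<in> space \<Omega>. ?g \<omega> \<and> val X \<omega> = x \<and> val Y \<omega> = y} = {\<omega> \<in> space \<Omega>. ?g \<omega> \<and> val X \<omega> = x}"
      "{\<omega> \<in> space \<Omega>. ?g \<omega> \<and> val Y \<omega> = y} = {\<omega> \<in> space \<Omega>. ?g \<omega>}"
      using assms(3) by auto
    then show ?thesis by (simp only:)
  next
    case False
    then have "{\<omega> \<in> space \<Omega>. ?g \<omega> \<and> val X \<omega> = x \<and> val Y \<omega> = y} = {}"
      "{\<omega> \<in> space \<Omega>. ?g \<omega> \<and> val Y \<omega> = y} = {}"
      using assms(3) by auto
    then show ?thesis by (simp only: measure_empty mult_zero_left mult_zero_right)
  qed
qed

section \<open>Independence given the observed ancestors\<close>

text \<open>\<open>B\<close> is left open to cover both the law seen by the algorithm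
  (\<open>N\<close>) and the law in the definition of labels (\<open>V\<close>).\<close>

lemma cond_indep_given_observed_ancestors:
  assumes C: "C \<subseteq> observed_roots E N" and YX: "(Y, X) \<in> E"
    and indep: "not_function_of E D M f C c X Y"
    and XN: "X \<in> N" and YN: "Y \<in> N" and sep: "d_separable (E - {(Y, X)}) N X Y"
    and B: "N \<subseteq> B" "B \<subseteq> V"
  shows "cond_indep (law_of \<Omega> D val B) C c (ancestors E {X, Y} \<inter> N - (C \<union> {X, Y})) X Y"
proof -
  define A where "A = ancestors E {X, Y}"
  define T where "T = A \<inter> N - (C \<union> {X, Y})"
  define H where "H = E - {(Y, X)}"
  \<comment> \<open>\<open>U\<close> contains the ancestors left free by conditioning;
    \<open>W\<close> is the moral component of \<open>Y\<close> among them.\<close>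
  define U where "U = A - N \<union> {X, Y}"
  define W where "W = {b. (Y, b) \<in> (moral_edges H A U)\<^sup>*}"
  have CN: "C \<subseteq> N" and roots: "\<And>Z. Z \<in> C \<Longrightarrow> parents E Z = {}"
    using C by (auto simp: observed_roots_def)
  have given_B: "C \<union> T \<union> {X, Y} \<subseteq> B"
    using CN XN YN B by (auto simp: T_def)
  have "cond_indep (law_of \<Omega> D val B) C c T X Y"
  \<comment> \<open>If \<open>Y\<close> is a control variable, it is fixed and yet lies in
    \<open>U\<close>, so this case is treated apart.\<close>
  proof (cases "Y \<in> C")
    case True
    then show ?thesis using cond_indep_of_determined B given_B by blast
  next
    case YC: False
    have XC: "X \<notin> C" using roots YX by (auto simp: parents_def)
    have "asym E" using wf_edges by (rule wf_imp_asym)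
    then have "asym H" by (auto simp: H_def asym_on_def)
    have AH: "A = ancestors H {X, Y}" by (simp add: A_def H_def ancestors_remove_edge)
    have XW: "X \<notin> W"
      using not_morally_connected[OF \<open>asym H\<close>, of N X Y U] sep unfolding W_def AH U_def H_def by auto
    have YW: "Y \<in> W" by (simp add: W_def)
    have WU: "W \<subseteq> U"
    proof
      fix b assume "b \<in> W"
      then show "b \<in> U" unfolding W_def
        by (auto elim: rtranclE simp: U_def moral_edges_def)
    qed
    \<comment> \<open>Free members of one family are moral neighbours, so they lie in
      \<open>W\<close> together or not at all.\<close>
    have W_closed: "b \<in> W" if "a \<in> W" "a \<in> family H Z" "b \<in> family H Z" "Z \<in> A" "b \<in> U" for a b Z
    proof -
      have "(a, b) \<in> moral_edges H A U" using that WU by (auto simp: moral_edges_def)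
      then show ?thesis using that(1) unfolding W_def by auto
    qed
    have "X \<in> V" "Y \<in> V" using XN YN observables by auto
    have AV: "A \<subseteq> V"
    proof
      fix Z assume "Z \<in> A"
      then show "Z \<in> V" using \<open>X \<in> V\<close> \<open>Y \<in> V\<close> edges
        by (auto simp: A_def ancestors_def elim: converse_rtranclE)
    qed
    have A_closed: "parents E Z \<subseteq> A" if "Z \<in> A" for Z
      using that by (auto simp: A_def ancestors_def parents_def intro: converse_rtrancl_into_rtrancl)
    \<comment> \<open>Control variables may lie outside \<open>A\<close> but occur in the
      conditioning event; as roots they keep the set parent-closed.\<close>
    define A' where "A' = A \<union> C"
    have A'V: "A' \<subseteq> V" using AV CN observables by (auto simp: A'_def)
    have A'_closed: "parents E Z \<subseteq> A'" if "Z \<in> A'" for Z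
      using that A_closed roots by (auto simp: A'_def)
    have A'_cover: "A' \<subseteq> C \<union> T \<union> U" by (auto simp: A'_def T_def U_def)
    have XYA: "X \<in> A" "Y \<in> A" by (auto simp: A_def ancestors_def)
    have CTU: "(C \<union> T) \<inter> U = {}" using CN XC YC by (auto simp: T_def U_def)
    have CTV: "C \<union> T \<subseteq> V" using CN observables by (auto simp: T_def)
    have parents_H: "parents H Z = parents E Z" if "Z \<noteq> X" for Z
      using that by (auto simp: H_def parents_def)
    have parents_HX: "parents H X = parents E X - {Y}"
      by (auto simp: H_def parents_def)
    define G where "G = {Z \<in> A'. family H Z \<inter> W \<noteq> {}}"
    have GV: "G \<subseteq> V" "A' - G \<subseteq> V" using A'V by (auto simp: G_def)
    show ?thesis
    proof (rule cond_indep_law_ofI[OF B(2) given_B], unfold Let_def)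
      fix s x y
      let ?g = "\<lambda>\<omega>. (\<forall>W\<in>C. val W \<omega> = c W) \<and> (\<forall>W\<in>T. val W \<omega> = s W)"
      define t where "t Z = (if Z \<in> C then c Z else s Z)" for Z
      have g_iff: "?g \<omega> \<longleftrightarrow> (\<forall>Z\<in>C \<union> T. val Z \<omega> = t Z)" for \<omega>
        by (auto simp: t_def T_def)
      define P where "P Z Q = {v \<in> PiE V D. (\<forall>Z\<in>C \<union> T. v Z = t Z) \<and> Q (v Z)}"
        for Z :: 'v and Q :: "'a \<Rightarrow> bool"
      have P_sub: "P Z Q \<subseteq> PiE V D" for Z Q by (auto simp: P_def)
      \<comment> \<open>Predicates \<open>Q\<close> and \<open>Q'\<close> are used so that the
        constantly true one yields the marginal events. The actual values solve both systems;
        conversely, two solutions are glued into one.\<close>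
      have split: "{\<omega> \<in> space \<Omega>. ?g \<omega> \<and> Q (val X \<omega>) \<and> Q' (val Y \<omega>)} =
        solvable (P Y Q') G \<inter> solvable (P X Q) (A' - G)" (is "?L = ?R") for Q Q'
      proof
        show "?L \<subseteq> ?R"
        proof
          fix \<omega> assume \<omega>: "\<omega> \<in> ?L"
          define v where "v = restrict (\<lambda>Z. val Z \<omega>) V"
          have "v \<in> PiE V D" using val_in_domain \<omega> by (auto simp: v_def)
          then have "v \<in> P Y Q'" "v \<in> P X Q"
            using \<omega> \<open>X \<in> V\<close> \<open>Y \<in> V\<close> CTV unfolding P_def g_iff by (auto simp: v_def)
          moreover have "f Z (restrict v (parents E Z)) (\<epsilon> Z \<omega>) = v Z" if "Z \<in> V" for Z
          proof -
            have "restrict v (parents E Z) = restrict (\<lambda>Y. val Y \<omega>) (parents E Z)"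
              using parents_subset by (intro restrict_ext) (auto simp: v_def)
            then show ?thesis using structural_equation[of Z \<omega>] \<omega> that by (simp add: v_def)
          qed
          ultimately show "\<omega> \<in> ?R" using \<omega> GV unfolding solvable_def by blast
        qed
        show "?R \<subseteq> ?L"
        proof
          fix \<omega> assume "\<omega> \<in> ?R"
          then obtain v1 v2 where \<omega>: "\<omega> \<in> space \<Omega>" and v1: "v1 \<in> P Y Q'" and v2: "v2 \<in> P X Q"
            and eq1: "\<And>Z. Z \<in> G \<Longrightarrow> f Z (restrict v1 (parents E Z)) (\<epsilon> Z \<omega>) = v1 Z"
            and eq2: "\<And>Z. Z \<in> A' - G \<Longrightarrow> f Z (restrict v2 (parents E Z)) (\<epsilon> Z \<omega>) = v2 Z"
            unfolding solvable_def by blast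
          \<comment> \<open>The glued solution follows \<open>v1\<close> on \<open>W\<close> and
            \<open>v2\<close> elsewhere; both equal \<open>t\<close> on \<open>C\<close> and
            \<open>T\<close>.\<close>
          define v where "v Z = (if Z \<in> W then v1 Z else v2 Z)" for Z
          have v_t: "v Z = t Z" if "Z \<in> C \<union> T" for Z
            using that v1 v2 by (auto simp: v_def P_def)
          have sol: "f Z (restrict v (parents E Z)) (\<epsilon> Z \<omega>) = v Z" if Z: "Z \<in> A'" for Z
          proof (cases "Z \<in> G")
            case True
            then obtain w where w: "w \<in> family H Z" "w \<in> W" by (auto simp: G_def)
            have "Z \<noteq> X"
              using W_closed[OF w(2,1), of X] XW XYA by (auto simp: family_def U_def)
            have "Z \<in> A"
            proof (rule ccontr)
              assume "Z \<notin> A"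
              then have "Z \<in> C" using Z by (auto simp: A'_def)
              then have "w = Z" using w(1) roots by (auto simp: family_def parents_def H_def)
              then show False using w(2) WU CTU \<open>Z \<in> C\<close> by auto
            qed
            have "v u = v1 u" if u: "u \<in> family H Z" for u
            proof (cases "u \<in> W")
              case False
              \<comment> \<open>A family member outside \<open>W\<close> cannot be free, so its
                value is fixed by conditioning.\<close>
              then have "u \<notin> U" using W_closed[OF w(2,1) u \<open>Z \<in> A\<close>] by auto
              moreover have "u \<in> A'"
                using u Z A'_closed[OF Z] by (auto simp: family_def parents_def H_def)
              ultimately have "u \<in> C \<union> T" using A'_cover by auto
              then show ?thesis using v_t v1 by (auto simp: P_def)
            qed (simp add: v_def)
            then have "restrict v (parents E Z) = restrict v1 (parents E Z)" "v Z = v1 Z"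
              using parents_H[OF \<open>Z \<noteq> X\<close>] by (auto simp: family_def intro!: restrict_ext)
            then show ?thesis using eq1[OF True] by simp
          next
            case False
            then have v_v2: "v u = v2 u" if "u \<in> family H Z" for u
              using that Z by (auto simp: G_def v_def)
            have "f Z (restrict v (parents E Z)) (\<epsilon> Z \<omega>) = f Z (restrict v2 (parents E Z)) (\<epsilon> Z \<omega>)"
            proof (cases "Z = X")
              \<comment> \<open>At \<open>X\<close> the two assignments may differ in the parent
                \<open>Y\<close>, which lies in \<open>W\<close>; this is where \<open>f X\<close>
                ignoring \<open>Y\<close> is used.\<close>
              case True
              have dom: "restrict v (parents E X) \<in> PiE (parents E X) D"
                "restrict v2 (parents E X) \<in> PiE (parents E X) D"
                using v1 v2 parents_subset[of X] by (auto simp: v_def P_def PiE_def Pi_def)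
              have on_C: "v u = c u \<and> v2 u = c u" if "u \<in> C" for u
                using that v_t[of u] v2 by (auto simp: t_def P_def)
              have "v u = v2 u" if "u \<in> parents E X - {Y}" for u
                using v_v2[of u] that True by (auto simp: family_def parents_HX)
              then have "\<forall>e\<in>space (M X).
                  f X (restrict v (parents E X)) e = f X (restrict v2 (parents E X)) e"
                using indep[unfolded not_function_of_def, rule_format, OF dom] on_C by auto
              then show ?thesis
                using True measurable_space[OF measurable_noise[OF \<open>X \<in> V\<close>] \<omega>] by blast
            next
              case False
              then have "restrict v (parents E Z) = restrict v2 (parents E Z)"
                using v_v2 parents_H by (intro restrict_ext) (auto simp: family_def)
              then show ?thesis by simp
            qed
            then show ?thesis using eq2[of Z] Z False v_v2[of Z] by (simp add: family_def)
          qed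
          \<comment> \<open>\<open>A'\<close> is parent-closed, so the glued solution gives the
            actual values.\<close>
          have val: "val Z \<omega> = v Z" if "Z \<in> A'" for Z
            using val_unique[OF \<omega> A'V A'_closed sol that] .
          have "C \<union> T \<subseteq> A'" by (auto simp: A'_def T_def)
          then have "?g \<omega>" unfolding g_iff
            using val v_t by (metis subsetD)
          moreover have "val X \<omega> = v2 X" "val Y \<omega> = v1 Y"
            using val[of X] val[of Y] XYA XW YW by (auto simp: A'_def v_def)
          ultimately show "\<omega> \<in> ?L" using v1 v2 \<omega> by (auto simp: P_def)
        qed
      qed
      have prob_split: "\<P>(\<omega> in \<Omega>. ?g \<omega> \<and> Q (val X \<omega>) \<and> Q' (val Y \<omega>)) =
        prob (solvable (P Y Q') G) * prob (solvable (P X Q) (A' - G))" for Q Q'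
        unfolding split using indep_solvable[OF P_sub P_sub GV] by auto
      show "\<P>(\<omega> in \<Omega>. ?g \<omega> \<and> val X \<omega> = x \<and> val Y \<omega> = y) * \<P>(\<omega> in \<Omega>. ?g \<omega>) =
        \<P>(\<omega> in \<Omega>. ?g \<omega> \<and> val X \<omega> = x) * \<P>(\<omega> in \<Omega>. ?g \<omega> \<and> val Y \<omega> = y)"
        \<comment> \<open>Each of the four probabilities is a factor for \<open>Y\<close> times a
          factor for \<open>X\<close>, and both sides contain the same four factors.\<close>
        using prob_split[of "\<lambda>a. a = x" "\<lambda>a. a = y"] prob_split[of "\<lambda>_. True" "\<lambda>_. True"]
          prob_split[of "\<lambda>a. a = x" "\<lambda>_. True"] prob_split[of "\<lambda>_. True" "\<lambda>a. a = y"]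
        by simp
    qed
  qed
  then show ?thesis by (simp add: T_def A_def)
qed

end

theorem theorem2:
  fixes \<Omega> :: "'w measure"
    and V N C :: "'v set"
    and E H :: "('v \<times> 'v) set"
    and D :: "'v \<Rightarrow> 'a set"
    and M :: "'v \<Rightarrow> 'e measure"
    and \<epsilon> :: "'v \<Rightarrow> 'w \<Rightarrow> 'e"
    and f :: "'v \<Rightarrow> ('v \<Rightarrow> 'a) \<Rightarrow> 'e \<Rightarrow> 'a"
    and val :: "'v \<Rightarrow> 'w \<Rightarrow> 'a"
    and c :: "'v \<Rightarrow> 'a"
    and X Y :: 'v
  assumes "sem \<Omega> V N E D M \<epsilon> f val"
    and "C \<subseteq> observed_roots E N"
    and "c \<in> PiE C D"
    and "(Y, X) \<in> E"
    and "not_function_of E D M f C c X Y"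
    and "H = E - {(Y, X)}"
    and "X \<in> N" and "Y \<in> N"
    and "d_separable H N X Y"
  shows "(Y, X) \<in> learned_labels E N D C (law_of \<Omega> D val N) c \<and>
         (Y, X) \<in> valid_labels (law_of \<Omega> D val V) V E C c"
proof -
  interpret sem \<Omega> V N E D M \<epsilon> f val by fact
  let ?T = "ancestors E {X, Y} \<inter> N - (C \<union> {X, Y})"
  have indep: "cond_indep (law_of \<Omega> D val B) C c ?T X Y" if "N \<subseteq> B" "B \<subseteq> V" for B
    using cond_indep_given_observed_ancestors[OF assms(2,4,5,7,8) _ that] assms(6,9) by simp
  have "(Y, X) \<in> learned_labels E N D C (law_of \<Omega> D val N) c"
    using indep[of N] observables assms by (simp add: learned_labels_def)
  \<comment> \<open>The conditioning set of the algorithm itself witnesses the label.\<close>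
  moreover have "(Y, X) \<in> valid_labels (law_of \<Omega> D val V) V E C c"
    using indep[of V] observables assms(4) by (auto simp: valid_labels_def intro!: exI[of _ ?T])
  ultimately show ?thesis ..
qed

end
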